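(* For the revenue-maximization variant of the online stopping problem with adversarial buyer values, no (possibly randomized) seller algorithm achieves worst-case regret strictly less than $1/e$; the hard instance can be taken to consist of a single buyer.
   Context: Revenue-maximization variant: a seller sells one item to $n$ buyers arriving sequentially; buyer $i$ has value $x_i\in[0,1]$. Before buyer $i$ arrives, the seller posts a price $p_i$; if $x_i\ge p_i$, buyer $i$ buys the item, the seller obtains revenue $p_i$, and the process ends. The regret is (the expectation of) $\max_i x_i$ minus the seller's expected revenue; the worst-case regret is the supremum over instances. *)

theory Defs
  imports "HOL-Probability.Probability"
begin

text \<open>
  A pricing policy maps the list of values of the buyers who have already declined (in order
  of arrival) to the next price. Letting the seller see these values only enlarges the class of
  algorithms: a seller who merely observes the rejections uses the length of the list. A price
  above 1 amounts to not offering the item.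
\<close>

fun revenue :: "(real list \<Rightarrow> real) \<Rightarrow> real list \<Rightarrow> real list \<Rightarrow> real" where
  "revenue p h [] = 0"
| "revenue p h (x # xs) = (if x \<ge> p h then p h else revenue p (h @ [x]) xs)"

text \<open>
  All internal randomness of the seller is a seed drawn from the probability space \<open>M\<close>;
  the seed selects the pricing policy.
\<close>

definition randomized_seller :: "'w measure \<Rightarrow> ('w \<Rightarrow> real list \<Rightarrow> real) \<Rightarrow> bool" where
  "randomized_seller M price \<longleftrightarrow>
     prob_space M \<and> (\<forall>h. (\<lambda>w. price w h) \<in> borel_measurable M)"

definition instances :: "nat \<Rightarrow> real list set" where
  "instances n = {xs. length xs = n \<and> set xs \<subseteq> {0..1}}"

text \<open>
  On instances the revenue is at most 1, so it can fail to be integrable only if unboundedly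
  negative prices are posted and the expected revenue is minus infinity. The integral is then 0
  by convention, which is in favour of the seller.
\<close>

definition regret :: "'w measure \<Rightarrow> ('w \<Rightarrow> real list \<Rightarrow> real) \<Rightarrow> real list \<Rightarrow> real" where
  "regret M price xs = Max (set xs) - (\<integral>w. revenue (price w) [] xs \<partial>M)"

text \<open>Extended reals, since negative prices may make the regret unbounded.\<close>

definition worst_case_regret :: "nat \<Rightarrow> 'w measure \<Rightarrow> ('w \<Rightarrow> real list \<Rightarrow> real) \<Rightarrow> ereal" where
  "worst_case_regret n M price = (SUP xs\<in>instances n. ereal (regret M price xs))"

end

theory Submission
  imports Defs
begin

text \<open>
  By Yao's principle it suffices to average the regret over a random value with
  distribution function \<open>1 - 1 / (e x)\<close> on \<open>[1/e, 1)\<close> and an atom of mass \<open>1/e\<close> at 1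
  (an equal-revenue distribution): its mean is \<open>2/e\<close>, while every posted price earns at most
  \<open>1/e\<close>. For \<open>n\<close> buyers, the first one is followed by buyers of value 0, who
  never add revenue.
\<close>

text \<open>If \<open>f\<close> is not integrable, its integral is 0 by convention; otherwise
  passing to the positive part can only raise it. This lets expected revenue be bounded without
  first proving it integrable.\<close>

lemma ennreal_integral_le_nn_integral:
  fixes f :: "'a \<Rightarrow> real"
  shows "ennreal (\<integral>w. f w \<partial>M) \<le> (\<integral>\<^sup>+w. ennreal (f w) \<partial>M)"
proof (cases "integrable M f")
  case True
  then have "(\<integral>w. f w \<partial>M) \<le> (\<integral>w. max 0 (f w) \<partial>M)"
    by (intro integral_mono) auto
  then have "ennreal (\<integral>w. f w \<partial>M) \<le> ennreal (\<integral>w. max 0 (f w) \<partial>M)"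
    by (rule ennreal_leI)
  also have "ennreal (\<integral>w. max 0 (f w) \<partial>M) = (\<integral>\<^sup>+w. ennreal (max 0 (f w)) \<partial>M)"
    using True by (intro nn_integral_eq_integral[symmetric]) auto
  also have "\<dots> = (\<integral>\<^sup>+w. ennreal (f w) \<partial>M)"
    by (intro nn_integral_cong) (auto simp: max_def ennreal_neg)
  finally show ?thesis .
next
  case False
  then show ?thesis by (simp add: not_integrable_integral_eq)
qed

lemma inverse_e_le_imp_pos:
  fixes x :: real
  shows "1 / exp 1 \<le> x \<Longrightarrow> 0 < x"
  by (rule less_le_trans[of _ "1 / exp 1"]) auto

text \<open>Scaled by \<open>e\<close>, so that the atom at 1 has weight 1 and every price earns at most 1.\<close>

abbreviation hard_density :: "real \<Rightarrow> ennreal" where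
  "hard_density x \<equiv> ennreal (1 / x\<^sup>2) * indicator {1 / exp 1..1} x"

text \<open>With \<open>q = max 0 p\<close> and \<open>a = max (1 / exp 1) p\<close>, a price
  \<open>p\<close> of at most 1 earns \<open>q\<close> at the atom and
  \<open>q * (1 / a - 1)\<close> from the density, in total \<open>q / a\<close>. Truncating at 0
  keeps negative prices within \<open>ennreal\<close>.\<close>

lemma hard_value_posted_price_revenue_le:
  fixes p :: real
  shows "ennreal (if p \<le> 1 then max 0 p else 0)
     + (\<integral>\<^sup>+x. ennreal (if p \<le> x then max 0 p else 0) * hard_density x \<partial>lborel) \<le> 1"
proof (cases "p \<le> 1")
  case False
  then have "ennreal (if p \<le> x then max 0 p else 0) * hard_density x = 0" for x
    by (auto simp: indicator_def)
  with False show ?thesis by (simp only: if_False nn_integral_const) simp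
next
  case True
  define a q where "a = max (1 / exp 1) p" and "q = max 0 p"
  have a: "0 < a" "a \<le> 1" "q \<le> a" "0 \<le> q"
    using True inverse_e_le_imp_pos[of a] unfolding a_def q_def by auto
  have "(\<integral>\<^sup>+x. ennreal (if p \<le> x then max 0 p else 0) * hard_density x \<partial>lborel)
     = (\<integral>\<^sup>+x. ennreal (q / x\<^sup>2) * indicator {a..1} x \<partial>lborel)"
    unfolding q_def[symmetric] using a
    by (intro nn_integral_cong) (auto simp: a_def indicator_def ennreal_mult[symmetric])
  also have "\<dots> = ennreal ((- q / 1) - (- q / a))"
    using a
    by (intro nn_integral_FTC_Icc)
       (auto intro!: derivative_eq_intros simp: power2_eq_square)
  finally have "ennreal (if p \<le> 1 then max 0 p else 0)
     + (\<integral>\<^sup>+x. ennreal (if p \<le> x then max 0 p else 0) * hard_density x \<partial>lborel)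
     = ennreal q + ennreal (q / a - q)"
    using True by (simp add: q_def)
  also have "\<dots> = ennreal (q / a)"
    using a by (subst ennreal_plus[symmetric]) (auto simp: field_simps mult_right_le_one_le mult_left_le_one_le)
  also have "\<dots> \<le> 1"
    using a by (simp add: ennreal_le_1)
  finally show ?thesis .
qed

text \<open>A regret below 1/e at \<open>x\<close> means an expected revenue above
  \<open>x - 1 / exp 1\<close>, which is nonnegative on the support. Together with 1 - 1/e from the
  atom, the average of this bound is exactly 1, the most that a price can earn.\<close>

lemma hard_value_benchmark:
  "(\<integral>\<^sup>+x. ennreal (x - 1 / exp 1) * hard_density x \<partial>lborel) = ennreal (1 / exp 1)"
proof -
  have "(\<integral>\<^sup>+x. ennreal (x - 1 / exp 1) * hard_density x \<partial>lborel)
     = (\<integral>\<^sup>+x. ennreal ((x - 1 / exp 1) / x\<^sup>2) * indicator {1 / exp 1..1} x \<partial>lborel)"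
    by (intro nn_integral_cong) (auto simp: indicator_def ennreal_mult[symmetric])
  \<comment> \<open>The antiderivative \<open>ln x + 1 / (exp 1 * x)\<close> is 1/e at 1 and
    vanishes at 1/e.\<close>
  also have "\<dots> = ennreal ((ln 1 + 1 / exp 1 / 1) - (ln (1 / exp 1) + 1 / exp 1 / (1 / exp 1)))"
  proof (rule nn_integral_FTC_Icc)
    fix x :: real
    assume x: "x \<in> {1 / exp 1..1}"
    then have "0 < x" by (simp add: inverse_e_le_imp_pos)
    then show "((\<lambda>x. ln x + 1 / exp 1 / x) has_real_derivative (x - 1 / exp 1) / x\<^sup>2) (at x)"
      by (auto intro!: derivative_eq_intros simp: power2_eq_square field_simps)
    show "0 \<le> (x - 1 / exp 1) / x\<^sup>2" using x by simp
  qed auto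
  also have "\<dots> = ennreal (1 / exp 1)" by (simp add: ln_div)
  finally show ?thesis .
qed

text \<open>The function \<open>f\<close> is only bounded above, so it can be the revenue of a whole
  instance, including what later prices contribute.\<close>

lemma posted_price_regret_ge:
  fixes p :: "'w \<Rightarrow> real" and f :: "real \<Rightarrow> 'w \<Rightarrow> real"
  assumes "prob_space M" and p [measurable]: "p \<in> borel_measurable M"
    and f: "\<And>x w. f x w \<le> (if p w \<le> x then max 0 (p w) else 0)"
  shows "\<exists>x\<in>{1 / exp 1..1}. x - (\<integral>w. f x w \<partial>M) \<ge> 1 / exp 1"
proof (rule ccontr)
  assume "\<not> ?thesis"
  then have R: "x - 1 / exp 1 < (\<integral>w. f x w \<partial>M)" if "x \<in> {1 / exp 1..1}" for x
    using that by force
  interpret prob_space M by fact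
  interpret pair_sigma_finite M lborel ..
  \<comment> \<open>A jointly measurable majorant of \<open>f\<close>, to which Tonelli's theorem
    applies.\<close>
  define g where "g w x = ennreal (if p w \<le> x then max 0 (p w) else 0)" for w x
  have g [measurable]: "(\<lambda>(w, x). g w x) \<in> borel_measurable (M \<Otimes>\<^sub>M lborel)"
    unfolding g_def by measurable
  have fg: "ennreal (\<integral>w. f x w \<partial>M) \<le> (\<integral>\<^sup>+w. g w x \<partial>M)" for x
    by (rule order_trans[OF ennreal_integral_le_nn_integral])
       (auto simp: g_def intro!: nn_integral_mono ennreal_leI f)
  have "ennreal (1 / exp 1) \<le> (\<integral>\<^sup>+x. (\<integral>\<^sup>+w. g w x \<partial>M) * hard_density x \<partial>lborel)"
    unfolding hard_value_benchmark[symmetric]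
  proof (intro nn_integral_mono)
    fix x :: real
    have "ennreal (x - 1 / exp 1) \<le> (\<integral>\<^sup>+w. g w x \<partial>M)" if "x \<in> {1 / exp 1..1}"
      by (rule order_trans[OF ennreal_leI fg]) (use R[OF that] in simp)
    then show "ennreal (x - 1 / exp 1) * hard_density x
        \<le> (\<integral>\<^sup>+w. g w x \<partial>M) * hard_density x"
      by (cases "x \<in> {1 / exp 1..1}") (auto intro!: mult_right_mono)
  qed
  also have "\<dots> = (\<integral>\<^sup>+x. (\<integral>\<^sup>+w. g w x * hard_density x \<partial>M) \<partial>lborel)"
    by (intro nn_integral_cong nn_integral_multc[symmetric]) simp
  also have "\<dots> = (\<integral>\<^sup>+w. (\<integral>\<^sup>+x. g w x * hard_density x \<partial>lborel) \<partial>M)"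
    by (rule Fubini') measurable
  \<comment> \<open>Adding the contribution of the atom at 1 makes the pointwise bound by 1
    applicable for each seed.\<close>
  finally have "ennreal (\<integral>w. f 1 w \<partial>M) + ennreal (1 / exp 1)
      \<le> (\<integral>\<^sup>+w. g w 1 \<partial>M) + \<dots>"
    by (intro add_mono fg)
  also have "\<dots> = (\<integral>\<^sup>+w. g w 1 + (\<integral>\<^sup>+x. g w x * hard_density x \<partial>lborel) \<partial>M)"
    by (rule nn_integral_add[symmetric]) measurable
  also have "\<dots> \<le> (\<integral>\<^sup>+w. 1 \<partial>M)"
    unfolding g_def by (intro nn_integral_mono hard_value_posted_price_revenue_le)
  also have "\<dots> = 1" by (simp add: emeasure_space_1)
  finally have le: "ennreal (\<integral>w. f 1 w \<partial>M) + ennreal (1 / exp 1) \<le> 1" .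
  \<comment> \<open>Averaging over the density gave only a weak inequality; strictness comes from
    the atom. The integral must be known nonnegative, since \<open>ennreal\<close> sends negative
    reals to 0.\<close>
  have "1 - 1 / exp 1 < (\<integral>w. f 1 w \<partial>M)" using R[of 1] by simp
  moreover have "(0::real) \<le> 1 - 1 / exp 1" by simp
  ultimately have "0 \<le> (\<integral>w. f 1 w \<partial>M)" "1 < (\<integral>w. f 1 w \<partial>M) + 1 / exp 1"
    by linarith+
  with le show False
    by (simp add: ennreal_plus[symmetric] ennreal_le_1 del: ennreal_plus)
qed

text \<open>A buyer of value 0 accepts only prices that are at most 0.\<close>

lemma revenue_replicate_zero_nonpos: "revenue p h (replicate k 0) \<le> 0"
  by (induction k arbitrary: h) auto

lemma regret_Cons_zeros_ge:
  assumes "randomized_seller M price"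
  shows "\<exists>x\<in>{1 / exp 1..1}. regret M price (x # replicate k 0) \<ge> 1 / exp 1"
proof -
  have "\<exists>x\<in>{1 / exp 1..1}.
      x - (\<integral>w. revenue (price w) [] (x # replicate k 0) \<partial>M) \<ge> 1 / exp 1"
  proof (rule posted_price_regret_ge)
    show "prob_space M" "(\<lambda>w. price w []) \<in> borel_measurable M"
      using assms by (auto simp: randomized_seller_def)
    show "revenue (price w) [] (x # replicate k 0)
        \<le> (if price w [] \<le> x then max 0 (price w []) else 0)" for x w
      by (simp add: revenue_replicate_zero_nonpos)
  qed
  then obtain x where x: "x \<in> {1 / exp 1..1}"
    "x - (\<integral>w. revenue (price w) [] (x # replicate k 0) \<partial>M) \<ge> 1 / exp 1"
    by blast
  from x(1) have "0 < x" by (simp add: inverse_e_le_imp_pos)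
  then have "Max (set (x # replicate k 0)) = x"
    by (intro Max_eqI) auto
  with x show ?thesis unfolding regret_def by metis
qed

theorem theoremA4:
  fixes M :: "'w measure" and price :: "'w \<Rightarrow> real list \<Rightarrow> real" and n :: nat
  assumes "n \<ge> 1" and "randomized_seller M price"
  shows "\<not> worst_case_regret n M price < ereal (1 / exp 1) \<and>
         (\<exists>x\<in>{0..1}. regret M price [x] \<ge> 1 / exp 1)"
proof
  have nonneg: "0 \<le> y" if "y \<in> {1 / exp 1..1}" for y :: real
    using that by (simp add: inverse_e_le_imp_pos less_imp_le)
  obtain x where x: "x \<in> {1 / exp 1..1}"
    "regret M price (x # replicate (n - 1) 0) \<ge> 1 / exp 1"
    using regret_Cons_zeros_ge[OF assms(2)] by blast
  have "x # replicate (n - 1) 0 \<in> instances n"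
    using x(1) nonneg[OF x(1)] assms(1) by (auto simp: instances_def)
  then have "ereal (1 / exp 1) \<le> worst_case_regret n M price"
    unfolding worst_case_regret_def using x(2) by (intro SUP_upper2) auto
  then show "\<not> worst_case_regret n M price < ereal (1 / exp 1)" by (simp add: not_less)
  \<comment> \<open>The hard value may depend on the number of trailing zeros, so the single-buyer
    case takes its own witness.\<close>
  obtain y where y: "y \<in> {1 / exp 1..1}" "regret M price [y] \<ge> 1 / exp 1"
    using regret_Cons_zeros_ge[OF assms(2), of 0] by auto
  with nonneg[OF y(1)] show "\<exists>x\<in>{0..1}. regret M price [x] \<ge> 1 / exp 1"
    by (intro bexI[of _ y]) auto
qed

end
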